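(* Let $a,b,c\in\mathbb{N}$ with $a\le b\le c$, $3a<b+c$ and $2b\le c$. Then $f(a,b,c)=c-1$.
   Context: $\mathbb{N}$ denotes the positive integers and $[n]=\{1,\dots,n\}$. For $a,b,c\in\mathbb{N}$, $f(a,b,c)$ denotes the metric dimension of the Cartesian product $K_a\times K_b\times K_c$ of complete graphs (vertex set $[a]\times[b]\times[c]$, two triples adjacent iff they differ in exactly one coordinate); the metric dimension of a graph is the minimum size of a vertex set $U$ such that every vertex is uniquely determined by its vector of distances to the vertices of $U$. Equivalently, $f(a,b,c)$ is the minimum cardinality of a set $Q\subseteq[a]\times[b]\times[c]$ such that for all distinct $s,s'$ there is $q\in Q$ with $g(s,q)\neq g(s',q)$, where $g(s,q)$ is the number of indices $i\in[3]$ with $s_i=q_i$. *)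

theory Defs
  imports "Graph_Theory.Graph_Theory"
begin

(* Simple graphs are symmetric loop-free pair digraphs (pair_graph); each undirected edge
   {u, v} is represented by the two arcs (u, v) and (v, u). *)

definition complete_graph :: "nat \<Rightarrow> nat pair_pre_digraph" where
  "complete_graph n =
     \<lparr>pverts = {1..n}, parcs = {(u, v). u \<in> {1..n} \<and> v \<in> {1..n} \<and> u \<noteq> v}\<rparr>"

definition cartesian_product ::
    "'a pair_pre_digraph \<Rightarrow> 'b pair_pre_digraph \<Rightarrow> ('a \<times> 'b) pair_pre_digraph" where
  "cartesian_product G H =
     \<lparr>pverts = pverts G \<times> pverts H,
      parcs = {((u, v), (u', v')).
                 (u = u' \<and> u \<in> pverts G \<and> (v, v') \<in> parcs H) \<or>
                 ((u, u') \<in> parcs G \<and> v = v' \<and> v \<in> pverts H)}\<rparr>"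

(* Minimum number of arcs of a walk (all arcs have cost 1); infinite if there is no walk. *)
definition graph_distance :: "'a pair_pre_digraph \<Rightarrow> 'a \<Rightarrow> 'a \<Rightarrow> ereal" where
  "graph_distance G = wf_digraph.\<mu> (with_proj G) (\<lambda>_. 1)"

definition resolving_set :: "'a pair_pre_digraph \<Rightarrow> 'a set \<Rightarrow> bool" where
  "resolving_set G U \<longleftrightarrow>
     U \<subseteq> pverts G \<and>
     (\<forall>s\<in>pverts G. \<forall>t\<in>pverts G.
        (\<forall>u\<in>U. graph_distance G s u = graph_distance G t u) \<longrightarrow> s = t)"

(* Intended for graphs with finitely many vertices, where the full vertex set is resolving
   and so the minimum exists. *)
definition metric_dimension :: "'a pair_pre_digraph \<Rightarrow> nat" where
  "metric_dimension G = (LEAST k. \<exists>U. resolving_set G U \<and> finite U \<and> card U = k)"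

definition f :: "nat \<Rightarrow> nat \<Rightarrow> nat \<Rightarrow> nat" where
  "f a b c = metric_dimension
     (cartesian_product (complete_graph a)
        (cartesian_product (complete_graph b) (complete_graph c)))"

lemma complete_digraph_complete_graph: "K\<^bsub>n\<^esub> (with_proj (complete_graph n))"
  by (auto simp: complete_digraph_pair_def complete_graph_def)

lemma pair_graph_complete_graph: "pair_graph (complete_graph n)"
  by (rule pair_graphI_complete[OF complete_digraph_complete_graph])

lemma pair_graph_cartesian_product:
  assumes "pair_graph G" "pair_graph H"
  shows "pair_graph (cartesian_product G H)"
proof -
  interpret G: pair_graph G by fact
  interpret H: pair_graph H by fact
  let ?P = "cartesian_product G H"
  have sub: "parcs ?P \<subseteq> pverts ?P \<times> pverts ?P"
    by (auto simp: cartesian_product_def dest: G.in_arcsD1 G.in_arcsD2 H.in_arcsD1 H.in_arcsD2)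
  have fin: "finite (pverts ?P)"
    by (simp add: cartesian_product_def G.pair_finite_verts H.pair_finite_verts)
  have "finite (parcs ?P)"
    using finite_subset[OF sub] fin by blast
  moreover have "symmetric (with_proj ?P)"
    using G.pair_sym_arcs H.pair_sym_arcs
    by (auto simp: symmetric_def sym_def cartesian_product_def)
  moreover have "fst e \<noteq> snd e" if "e \<in> parcs ?P" for e
    using that by (auto simp: cartesian_product_def dest: G.pair_no_loops H.pair_no_loops)
  ultimately show ?thesis
    using sub fin by unfold_locales auto
qed

(* Two triples are adjacent iff they differ in exactly one coordinate. *)
lemma arcs_product_complete_graphs:
  "((i, j, k), (i', j', k')) \<in>
     parcs (cartesian_product (complete_graph a)
       (cartesian_product (complete_graph b) (complete_graph c))) \<longleftrightarrow>
   {i, i'} \<subseteq> {1..a} \<and> {j, j'} \<subseteq> {1..b} \<and> {k, k'} \<subseteq> {1..c} \<and>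
   of_bool (i \<noteq> i') + of_bool (j \<noteq> j') + of_bool (k \<noteq> k') = (1::nat)"
  by (auto simp: cartesian_product_def complete_graph_def of_bool_def)

(* The library's distance is specified only under well-formedness; here is its meaning. *)
lemma graph_distance_eq:
  assumes "pair_graph G"
  shows "graph_distance G u v =
    (INF p \<in> {p. pre_digraph.awalk (with_proj G) u p v}. ereal (real (length p)))"
proof -
  interpret pair_graph G by fact
  show ?thesis
    by (simp add: graph_distance_def \<mu>_def awalk_cost_def sum_list_triv)
qed

end

theory Submission
  imports Defs
begin

text \<open>
  Distances in the product are Hamming distances. If two values of the third coordinate are missed
  by \<open>U\<close>, two triples differing only there are not separated; this gives \<open>c - 1 \<le> f a b c\<close>.
  A set of \<open>c - 1\<close> triples whose third coordinates are distinct is a bipartite multigraph on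
  \<open>[a]\<close> and \<open>[b]\<close> with labelled edges. For \<open>a \<ge> 2\<close> it is resolving as soon as every vertex in \<open>[a]\<close> and all
  but one vertex in \<open>[b]\<close> have two different neighbours. Joining \<open>j\<close> to \<open>j mod a\<close> and to
  \<open>(j + 1) mod a\<close> (a cycle wrapped around \<open>[a]\<close>) achieves this with \<open>2 b - 1\<close> edges if \<open>a < b\<close> and
  with \<open>2 b\<close> edges if \<open>a = b\<close>, and \<open>3 a < b + c\<close> excludes exactly \<open>a = b\<close>, \<open>c = 2 b\<close>.
  For \<open>a = 1\<close> all but one vertex in \<open>[b]\<close> need only have two edges.
\<close>

section \<open>Hamming distance as graph distance\<close>

abbreviation complete_product :: "nat \<Rightarrow> nat \<Rightarrow> nat \<Rightarrow> (nat \<times> nat \<times> nat) pair_pre_digraph" where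
  "complete_product a b c \<equiv>
     cartesian_product (complete_graph a) (cartesian_product (complete_graph b) (complete_graph c))"

fun hamming :: "nat \<times> nat \<times> nat \<Rightarrow> nat \<times> nat \<times> nat \<Rightarrow> nat" where
  "hamming (i, j, k) (i', j', k') = of_bool (i \<noteq> i') + of_bool (j \<noteq> j') + of_bool (k \<noteq> k')"

lemma hamming_self [simp]: "hamming s s = 0"
  by (cases s) simp

lemma hamming_triangle: "hamming s u \<le> hamming s t + hamming t u"
  by (cases s; cases t; cases u) auto

lemma pverts_complete_product: "pverts (complete_product a b c) = {1..a} \<times> {1..b} \<times> {1..c}"
  by (simp add: cartesian_product_def complete_graph_def)

lemma parcs_complete_product:
  "(s, t) \<in> parcs (complete_product a b c) \<longleftrightarrow>
     s \<in> pverts (complete_product a b c) \<and> t \<in> pverts (complete_product a b c) \<and> hamming s t = 1"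
  by (cases s; cases t) (auto simp: pverts_complete_product arcs_product_complete_graphs)

lemma pair_graph_complete_product: "pair_graph (complete_product a b c)"
  by (intro pair_graph_cartesian_product pair_graph_complete_graph)

text \<open>Each arc changes one coordinate, so the triangle inequality applies along the
  walk.\<close>

lemma hamming_le_awalk_length:
  assumes "pre_digraph.awalk (with_proj (complete_product a b c)) s p t"
  shows "hamming s t \<le> length p"
proof -
  interpret pair_graph "complete_product a b c" by (rule pair_graph_complete_product)
  show ?thesis
    using assms
  proof (induction p arbitrary: s)
    case Nil
    then show ?case by (simp add: awalk_Nil_iff)
  next
    case (Cons e p)
    then have "e \<in> parcs (complete_product a b c)" "fst e = s" "awalk (snd e) p t"
      by (auto simp: awalk_Cons_iff)
    then have "hamming s (snd e) = 1"
      by (metis parcs_complete_product prod.collapse)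
    with Cons.IH[OF \<open>awalk (snd e) p t\<close>] hamming_triangle[of s t "snd e"] show ?case
      by simp
  qed
qed

text \<open>The coordinates are corrected one at a time; one that already agrees contributes the
  empty walk.\<close>

lemma ex_awalk_hamming:
  assumes "s \<in> pverts (complete_product a b c)" "t \<in> pverts (complete_product a b c)"
  shows "\<exists>p. pre_digraph.awalk (with_proj (complete_product a b c)) s p t \<and> length p = hamming s t"
proof -
  interpret pair_graph "complete_product a b c" by (rule pair_graph_complete_product)
  have step: "\<exists>p. awalk u p v \<and> length p = hamming u v"
    if "u \<in> pverts (complete_product a b c)" "v \<in> pverts (complete_product a b c)"
      "hamming u v \<le> 1" for u v
  proof (cases "u = v")
    case True
    with that show ?thesis by (intro exI[of _ "[]"]) (simp add: awalk_Nil_iff)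
  next
    case False
    with that(3) have "hamming u v = 1" by (cases u; cases v) (auto split: if_splits)
    with that show ?thesis
      by (intro exI[of _ "[(u, v)]"]) (simp add: awalk_Cons_iff awalk_Nil_iff parcs_complete_product)
  qed
  have le: "of_bool P \<le> Suc 0" for P
    by (cases P) auto
  obtain i j k i' j' k' where st: "s = (i, j, k)" "t = (i', j', k')"
    by (metis prod_cases3)
  from assms have verts: "(i', j, k) \<in> pverts (complete_product a b c)"
      "(i', j', k) \<in> pverts (complete_product a b c)"
    by (auto simp: st pverts_complete_product)
  obtain p where p: "awalk s p (i', j, k)" "length p = hamming s (i', j, k)"
    using step[OF assms(1) verts(1)] by (auto simp: st le)
  obtain q where q: "awalk (i', j, k) q (i', j', k)" "length q = hamming (i', j, k) (i', j', k)"
    using step[OF verts] by (auto simp: le)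
  obtain r where r: "awalk (i', j', k) r t" "length r = hamming (i', j', k) t"
    using step[OF verts(2) assms(2)] by (auto simp: st le)
  have "awalk s (p @ q @ r) t"
    using p(1) q(1) r(1) by (meson awalk_appendI)
  moreover have "length (p @ q @ r) = hamming s t"
    using p(2) q(2) r(2) by (simp add: st)
  ultimately show ?thesis by blast
qed

lemma graph_distance_complete_product:
  assumes "s \<in> pverts (complete_product a b c)" "t \<in> pverts (complete_product a b c)"
  shows "graph_distance (complete_product a b c) s t = ereal (real (hamming s t))"
  unfolding graph_distance_eq[OF pair_graph_complete_product]
proof (intro antisym INF_greatest)
  obtain p where p: "pre_digraph.awalk (with_proj (complete_product a b c)) s p t"
      "length p = hamming s t"
    using ex_awalk_hamming[OF assms] by blast
  then show "(INF p \<in> {p. pre_digraph.awalk (with_proj (complete_product a b c)) s p t}.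
      ereal (real (length p))) \<le> ereal (real (hamming s t))"
    by (intro INF_lower2[of p]) auto
qed (simp add: hamming_le_awalk_length)

lemma resolving_set_complete_product:
  "resolving_set (complete_product a b c) U \<longleftrightarrow>
     U \<subseteq> pverts (complete_product a b c) \<and>
     (\<forall>s\<in>pverts (complete_product a b c). \<forall>t\<in>pverts (complete_product a b c).
        (\<forall>u\<in>U. hamming s u = hamming t u) \<longrightarrow> s = t)"
proof -
  have "(\<forall>u\<in>U. graph_distance (complete_product a b c) s u =
      graph_distance (complete_product a b c) t u) \<longleftrightarrow> (\<forall>u\<in>U. hamming s u = hamming t u)"
    if "U \<subseteq> pverts (complete_product a b c)" "s \<in> pverts (complete_product a b c)"
      "t \<in> pverts (complete_product a b c)" for s t
    using that by (intro ball_cong) (auto simp: graph_distance_complete_product subset_iff)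
  then show ?thesis
    unfolding resolving_set_def by blast
qed

section \<open>Lower bound\<close>

lemma card_resolving_set_ge:
  assumes "resolving_set (complete_product a b c) U" "finite U" "0 < a" "0 < b"
  shows "c - 1 \<le> card U"
proof -
  let ?T = "(\<lambda>(i, j, k). k) ` U"
  have "k = k'" if "k \<in> {1..c} - ?T" "k' \<in> {1..c} - ?T" for k k'
  proof -
    \<comment> \<open>As neither \<open>k\<close> nor \<open>k'\<close> occurs in \<open>U\<close>,
      the third coordinate contributes 1 on both sides.\<close>
    have "hamming (1, 1, k) u = hamming (1, 1, k') u" if "u \<in> U" for u
      using that \<open>k \<in> _\<close> \<open>k' \<in> _\<close> by (cases u) (auto simp: image_iff split: prod.splits)
    moreover have "(1, 1, k) \<in> pverts (complete_product a b c)"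
        "(1, 1, k') \<in> pverts (complete_product a b c)"
      using that assms(3,4) by (auto simp: pverts_complete_product)
    ultimately have "(1::nat, 1::nat, k) = (1, 1, k')"
      using assms(1) unfolding resolving_set_complete_product by blast
    then show ?thesis by simp
  qed
  then have "card ({1..c} - ?T) \<le> 1"
    by (simp add: card_le_Suc0_iff_eq)
  moreover have "card {1..c} - card ?T \<le> card ({1..c} - ?T)"
    using assms(2) by (intro diff_card_le_card_Diff) simp
  moreover have "card ?T \<le> card U"
    using assms(2) by (rule card_image_le)
  ultimately show ?thesis by simp
qed

section \<open>A sufficient condition for resolving\<close>

text \<open>The triple \<open>(x q, y q, q)\<close> is the edge with label \<open>q\<close> between
  \<open>x q\<close> and \<open>y q\<close>. Quantifying over pairs \<open>j\<close>,
  \<open>j'\<close> in \<open>right\<close> expresses that at most one vertex of \<open>[b]\<close>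
  is exceptional.\<close>

context
  fixes a b n :: nat and x y :: "nat \<Rightarrow> nat"
  assumes left: "\<And>i. 2 \<le> a \<Longrightarrow> i \<in> {1..a} \<Longrightarrow>
      \<exists>r\<in>{1..n}. \<exists>r'\<in>{1..n}. x r = i \<and> x r' = i \<and> y r \<noteq> y r'"
    and right: "\<And>j j'. j \<in> {1..b} \<Longrightarrow> j' \<in> {1..b} \<Longrightarrow> j \<noteq> j' \<Longrightarrow> \<exists>l\<in>{j, j'}.
      \<exists>q\<in>{1..n}. \<exists>q'\<in>{1..n}. q \<noteq> q' \<and> y q = l \<and> y q' = l \<and> (2 \<le> a \<longrightarrow> x q \<noteq> x q')"
begin

text \<open>At an edge ending in \<open>j\<close> the second coordinate favours the first triple by
  one. Only a label equal to \<open>k'\<close> can offset this, and two edges cannot share it; edges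
  at \<open>j'\<close> likewise need the label \<open>k\<close>.\<close>

lemma separated_right:
  assumes "{j, j'} \<subseteq> {1..b}"
    and eq: "\<And>q. q \<in> {1..n} \<Longrightarrow> hamming (i, j, k) (x q, y q, q) = hamming (i, j', k') (x q, y q, q)"
  shows "j = j'"
proof (rule ccontr)
  assume ne: "j \<noteq> j'"
  from assms(1) have "j \<in> {1..b}" "j' \<in> {1..b}" by auto
  from right[OF this ne] obtain l q q' where lq: "l \<in> {j, j'}" "q \<in> {1..n}" "q' \<in> {1..n}"
      "q \<noteq> q'" "y q = l" "y q' = l"
    by blast
  from lq(1) consider "l = j" | "l = j'" by blast
  then show False
  proof cases
    case 1
    then have "q = k'" "q' = k'"
      using eq[OF lq(2)] eq[OF lq(3)] lq(5,6) ne by (simp_all add: of_bool_def split: if_splits)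
    with lq(4) show False by simp
  next
    case 2
    then have "q = k" "q' = k"
      using eq[OF lq(2)] eq[OF lq(3)] lq(5,6) ne by (simp_all add: of_bool_def split: if_splits)
    with lq(4) show False by simp
  qed
qed

text \<open>As before, both edges at \<open>i\<close> would need the label \<open>k'\<close>, but
  they are distinct since their ends in \<open>[b]\<close> differ.\<close>

lemma separated_left:
  assumes "{i, i'} \<subseteq> {1..a}"
    and eq: "\<And>q. q \<in> {1..n} \<Longrightarrow> hamming (i, j, k) (x q, y q, q) = hamming (i', j, k') (x q, y q, q)"
  shows "i = i'"
proof (rule ccontr)
  assume ne: "i \<noteq> i'"
  with assms(1) have "2 \<le> a" by auto
  then obtain r r' where r: "r \<in> {1..n}" "r' \<in> {1..n}" "x r = i" "x r' = i" "y r \<noteq> y r'"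
    using left[of i] assms(1) by blast
  show False
    using eq[OF r(1)] eq[OF r(2)] r ne by (auto simp: of_bool_def split: if_splits)
qed

text \<open>
  If \<open>i \<noteq> i'\<close>, one of the two edges at \<open>j'\<close> avoids \<open>i\<close> and \<open>i'\<close>; it uses up the single surplus
  \<open>k\<close>, so that every edge at \<open>i'\<close> must end in \<open>j\<close>.
\<close>
lemma not_separated_cross:
  assumes "{i, i'} \<subseteq> {1..a}" "j \<noteq> j'"
    and q: "q \<in> {1..n}" "q' \<in> {1..n}" "y q = j'" "y q' = j'" "2 \<le> a \<longrightarrow> x q \<noteq> x q'"
    and eq: "\<And>q. q \<in> {1..n} \<Longrightarrow> hamming (i, j, k) (x q, y q, q) = hamming (i', j', k') (x q, y q, q)"
  shows "i = i'"
proof (rule ccontr)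
  assume ne: "i \<noteq> i'"
  with assms(1) have a: "2 \<le> a" by auto
  have no: "x p \<noteq> i'" if "p \<in> {1..n}" "y p = j'" for p
    using eq[OF that(1)] that ne \<open>j \<noteq> j'\<close> by (auto simp: of_bool_def split: if_splits)
  from q(5) a have "x q \<noteq> i \<or> x q' \<noteq> i" by auto
  with q(1-4) obtain p where p: "p \<in> {1..n}" "y p = j'" "x p \<noteq> i" by blast
  have pk: "p = k"
    using eq[OF p(1)] no[OF p(1,2)] p \<open>j \<noteq> j'\<close> by (auto simp: of_bool_def split: if_splits)
  have "y r = j" if "r \<in> {1..n}" "x r = i'" for r
    using eq[OF that(1)] no[OF that(1)] no[OF p(1,2)] that ne pk
    by (auto simp: of_bool_def split: if_splits)
  moreover obtain r r' where "r \<in> {1..n}" "r' \<in> {1..n}" "x r = i'" "x r' = i'" "y r \<noteq> y r'"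
    using left[of i'] assms(1) a by blast
  ultimately show False by simp
qed

lemma separated:
  assumes "{i, i'} \<subseteq> {1..a}" "{j, j'} \<subseteq> {1..b}" "{k, k'} \<subseteq> {1..Suc n}"
    and eq: "\<And>q. q \<in> {1..n} \<Longrightarrow> hamming (i, j, k) (x q, y q, q) = hamming (i', j', k') (x q, y q, q)"
  shows "(i, j, k) = (i', j', k')"
proof -
  have "i = i'"
  proof (cases "j = j'")
    case True
    show ?thesis
      by (rule separated_left[OF assms(1) eq[folded True]])
  next
    case False
    from assms(2) have "j \<in> {1..b}" "j' \<in> {1..b}" by auto
    from right[OF this False] obtain l q q' where lq: "l \<in> {j, j'}" "q \<in> {1..n}" "q' \<in> {1..n}"
        "y q = l" "y q' = l" "2 \<le> a \<longrightarrow> x q \<noteq> x q'"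
      by blast
    from lq(1) consider "l = j'" | "l = j" by blast
    then show ?thesis
    proof cases
      case 1
      show ?thesis
        by (rule not_separated_cross[OF assms(1) False lq(2,3) lq(4,5)[unfolded 1] lq(6)]) (rule eq)
    next
      case 2
      \<comment> \<open>The two triples exchange roles, since now \<open>j\<close> is the vertex
        with two suitable edges.\<close>
      have "{i', i} \<subseteq> {1..a}" using assms(1) by auto
      then have "i' = i"
        by (rule not_separated_cross[OF _ False[symmetric] lq(2,3) lq(4,5)[unfolded 2] lq(6)])
          (rule eq[symmetric])
      then show ?thesis ..
    qed
  qed
  moreover from this have "j = j'"
    by (intro separated_right[OF assms(2), of i k k']) (use eq in simp)
  moreover have "k = k'"
  proof (rule ccontr)
    assume ne: "k \<noteq> k'"
    \<comment> \<open>Only \<open>Suc n\<close> is not a label, so \<open>k\<close> or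
      \<open>k'\<close> is one, and the edge carrying it separates the triples.\<close>
    with assms(3) have "k \<in> {1..n} \<or> k' \<in> {1..n}" by auto
    with eq[of k] eq[of k'] calculation ne show False by (auto simp: of_bool_def split: if_splits)
  qed
  ultimately show ?thesis by simp
qed

end

section \<open>The wrapped cycle\<close>

lemma wrapped_cycle_left:
  fixes a b n i :: nat
  assumes "2 \<le> a" "a \<le> b" "2 * b \<le> Suc n" "a = b \<Longrightarrow> 2 * b \<le> n" "i < a"
  shows "\<exists>r<n. \<exists>r'<n. (r mod b + r div b) mod a = i \<and> (r' mod b + r' div b) mod a = i
    \<and> r mod b \<noteq> r' mod b"
proof -
  \<comment> \<open>\<open>j\<close> is the cyclic predecessor of \<open>i\<close> modulo
    \<open>a\<close>. Edge \<open>i\<close> of the first round joins \<open>i\<close> to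
    \<open>i\<close>, and edge \<open>b + j\<close> of the second round joins \<open>j\<close> to
    \<open>i\<close>.\<close>
  define j where "j = (if i = 0 then a - 1 else i - 1)"
  have j: "j < a" "j \<noteq> i" "Suc j mod a = i"
    using assms(1,5) by (auto simp: j_def)
  \<comment> \<open>If \<open>a < b\<close>, then \<open>j \<le> b - 2\<close> and
    \<open>2 * b - 1\<close> edges suffice; if \<open>a = b\<close>, then \<open>j\<close> can be
    \<open>b - 1\<close>, which takes \<open>2 * b\<close> edges.\<close>
  have "b + j < n"
    using j(1) assms(2-4) by (cases "a = b") auto
  moreover have "i < n"
    using assms(2,3,5) by auto
  moreover have "(b + j) mod b = j" "(b + j) div b = 1" "i mod b = i" "i div b = 0"
    using j(1) assms(2,5) by auto
  ultimately show ?thesis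
    using j assms(5) by (intro exI[of _ i] exI[of _ "b + j"] conjI) auto
qed

text \<open>Edges \<open>j\<close> and \<open>b + j\<close> lead to consecutive residues modulo
  \<open>a\<close>, which differ once \<open>2 \<le> a\<close>.\<close>

lemma wrapped_cycle_right:
  fixes a b n j :: nat
  assumes "j < b" "b + j < n"
  shows "\<exists>q<n. \<exists>q'<n. q \<noteq> q' \<and> q mod b = j \<and> q' mod b = j
    \<and> (2 \<le> a \<longrightarrow> (q mod b + q div b) mod a \<noteq> (q' mod b + q' div b) mod a)"
proof -
  have "(b + j) mod b = j" "(b + j) div b = 1" "j mod b = j" "j div b = 0"
    using assms(1) by auto
  moreover have "j mod a \<noteq> Suc j mod a" if "2 \<le> a"
    using that by (simp add: mod_Suc)
  ultimately show ?thesis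
    using assms by (intro exI[of _ j] exI[of _ "b + j"] conjI) auto
qed

lemma ex_resolving_set:
  fixes a b n :: nat
  assumes "0 < a" "a \<le> b" "2 * b \<le> Suc n" "a = b \<Longrightarrow> 2 * b \<le> n"
  shows "\<exists>U. resolving_set (complete_product a b (Suc n)) U \<and> finite U \<and> card U = n"
proof -
  \<comment> \<open>The cycle is counted from 0, but vertices and labels from 1, hence the shifts.
    Edges beyond the second round continue the pattern and do no harm.\<close>
  define y where "y q = Suc ((q - 1) mod b)" for q
  define x where "x q = Suc (((q - 1) mod b + (q - 1) div b) mod a)" for q
  define U where "U = (\<lambda>q. (x q, y q, q)) ` {1..n}"
  have left: "\<exists>r\<in>{1..n}. \<exists>r'\<in>{1..n}. x r = i \<and> x r' = i \<and> y r \<noteq> y r'"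
    if "2 \<le> a" and "i \<in> {1..a}" for i
  proof -
    from that have "i - 1 < a" by auto
    then obtain r r' where "r < n" "r' < n" "(r mod b + r div b) mod a = i - 1"
        "(r' mod b + r' div b) mod a = i - 1" "r mod b \<noteq> r' mod b"
      using wrapped_cycle_left[OF \<open>2 \<le> a\<close> assms(2-4)] by blast
    with that show ?thesis
      by (intro bexI[of _ "Suc r"] bexI[of _ "Suc r'"]) (auto simp: x_def y_def)
  qed
  have right: "\<exists>l\<in>{j, j'}. \<exists>q\<in>{1..n}. \<exists>q'\<in>{1..n}.
      q \<noteq> q' \<and> y q = l \<and> y q' = l \<and> (2 \<le> a \<longrightarrow> x q \<noteq> x q')"
    if "j \<in> {1..b}" "j' \<in> {1..b}" "j \<noteq> j'" for j j'
  proof -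
    \<comment> \<open>The bound \<open>b + (l - 1) < n\<close> can fail only for
      \<open>l = b\<close>, namely when \<open>n = 2 * b - 1\<close>.\<close>
    from that have "\<exists>l\<in>{j, j'}. l - 1 < b \<and> b + (l - 1) < n \<and> 1 \<le> l"
      using assms(3) by auto
    then obtain l where l: "l \<in> {j, j'}" "l - 1 < b" "b + (l - 1) < n" "1 \<le> l"
      by blast
    obtain q q' where "q < n" "q' < n" "q \<noteq> q'" "q mod b = l - 1" "q' mod b = l - 1"
      "2 \<le> a \<longrightarrow> (q mod b + q div b) mod a \<noteq> (q' mod b + q' div b) mod a"
      using wrapped_cycle_right[OF l(2,3), of a] by blast
    with l(4) show ?thesis
      by (intro bexI[OF _ l(1)] bexI[of _ "Suc q"] bexI[of _ "Suc q'"]) (auto simp: x_def y_def)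
  qed
  have "U \<subseteq> pverts (complete_product a b (Suc n))"
    using assms(1,2) by (auto simp: U_def pverts_complete_product x_def y_def Suc_le_eq)
  moreover have "s = t" if "s \<in> pverts (complete_product a b (Suc n))"
      "t \<in> pverts (complete_product a b (Suc n))" "\<forall>u\<in>U. hamming s u = hamming t u" for s t
  proof -
    obtain i j k i' j' k' where st: "s = (i, j, k)" "t = (i', j', k')"
      by (metis prod_cases3)
    have "(i, j, k) = (i', j', k')"
    proof (rule separated[of a n x y b, OF left right])
      show "{i, i'} \<subseteq> {1..a}" "{j, j'} \<subseteq> {1..b}" "{k, k'} \<subseteq> {1..Suc n}"
        using that(1,2) by (auto simp: st pverts_complete_product)
      show "hamming (i, j, k) (x q, y q, q) = hamming (i', j', k') (x q, y q, q)"
        if "q \<in> {1..n}" for q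
        using \<open>\<forall>u\<in>U. _\<close> that unfolding U_def st by blast
    qed
    then show ?thesis by (simp add: st)
  qed
  ultimately have "resolving_set (complete_product a b (Suc n)) U"
    unfolding resolving_set_complete_product by blast
  moreover have "card U = n"
    unfolding U_def by (subst card_image) (auto simp: inj_on_def)
  ultimately show ?thesis
    by (auto simp: U_def)
qed

theorem theorem6:
  fixes a b c :: nat
  assumes "0 < a" "0 < b" "0 < c"
    and "a \<le> b" "b \<le> c"
    and "3 * a < b + c" "2 * b \<le> c"
  shows "f a b c = c - 1"
  unfolding f_def metric_dimension_def
proof (rule Least_equality)
  show "\<exists>U. resolving_set (complete_product a b c) U \<and> finite U \<and> card U = c - 1"
    \<comment> \<open>For \<open>a = b\<close> the assumption \<open>3 * a < b + c\<close> becomes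
      \<open>2 * b < c\<close>, so \<open>c - 1\<close> labels cover both rounds.\<close>
    using ex_resolving_set[of a b "c - 1"] assms by auto
next
  fix m
  assume "\<exists>U. resolving_set (complete_product a b c) U \<and> finite U \<and> card U = m"
  then show "c - 1 \<le> m"
    using card_resolving_set_ge assms(1,2) by blast
qed

end
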